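(* Let $W=W(\lambda)$ with $\lambda\in\mathbb R$ and Weyr characteristic $(w_1,\dots,w_m)$, assume $\mathcal P_{(W;\underline r)}\ne\emptyset$, let $P\in\mathcal P_{(W;\underline r)}$ and let $\underline{\mathcal I}=(\mathcal I_1,\dots,\mathcal I_m)$ be an admissible sequence of indices for $P$. Then $P$ is $\widetilde C_W$-equivalent to a unique $\widetilde C_W$-reduced form with respect to $\underline{\mathcal I}$.
   Context: Let $w_1\ge\cdots\ge w_m\ge1$ be integers and $s=\sum_i w_i$. For $p\ge q$, $I_{p,q}=\begin{bmatrix}I_q\\0\end{bmatrix}\in\mathbb R^{p\times q}$. $W(\lambda)\in\mathbb R^{s\times s}$ is the block matrix with diagonal blocks $\lambda I_{w_1},\dots,\lambda I_{w_m}$, $(i,i+1)$ blocks $I_{w_i,w_{i+1}}$, and all other blocks zero. Put $\tau_0=0$, $\tau_i=w_{m-i+1}$, $1\le i\le m$ (so $\tau_m=w_1$; some differences $\tau_i-\tau_{i-1}$ may be $0$, giving empty blocks). Let $\underline r:\ r=r_1\ge\cdots\ge r_k>0$ be integers. $\mathcal P_{(W;\underline r)}$ is the set of matrices $P=\begin{bmatrix}P_1\\ \vdots\\P_k\end{bmatrix}$ with $\operatorname{rank}P=s$, $P_1\in\mathbb R^{r\times s}$ and $P_i\in\mathbb R^{r_i\times s}$ equal to the first $r_i$ rows of $P_1W^{i-1}$. $\widetilde C_W$ is the group of invertible matrices commuting with $W$; $P,\widehat P$ are $\widetilde C_W$-equivalent if $\widehat P=PX$ for some $X\in\widetilde C_W$.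 $A(I,J)$ denotes the submatrix of $A$ with rows in $I$ and columns in $J$ (in the listed order); $A(I,:)$ uses all columns. $Q_{l,p}$ is the set of strictly increasing sequences of length $l$ in $\{1,\dots,p\}$, $Q_{0,p}=\{\emptyset\}$. An admissible sequence of indices for $P$ is $\underline{\mathcal I}=(\mathcal I_1,\dots,\mathcal I_m)$ where $\mathcal I_j=(i_1,\dots,i_{\tau_j})$ is a sequence of $\tau_j$ distinct indices in $\{1,\dots,r\}$ such that $\mathcal I_j\subseteq\mathcal I_{j+1}$ ($\mathcal I_j$ being an initial segment of $\mathcal I_{j+1}$), $\mathcal I_j\setminus\mathcal I_{j-1}=(i_{\tau_{j-1}+1},\dots,i_{\tau_j})\in Q_{\tau_j-\tau_{j-1},r}$ ($\mathcal I_0=\emptyset$), and $P(\mathcal I_j,1{:}\tau_j)$ is invertible, $1\le j\le m$. A matrix $R\in\mathcal P_{(W;\underline r)}$ with first block $R_1=[R_{11}\ R_{12}\ \cdots\ R_{1m}]$, $R_{1j}\in\mathbb R^{r\times w_j}$, is a $\widetilde C_W$-reduced form (of $P$) with respect to $\underline{\mathcal I}$ if, partitioning for each $j$ the matrix $R_{1j}(\mathcal I_m,:)\in\mathbb R^{w_1\times w_j}$ into blocks $R^{(j)}_{ik}\in\mathbb R^{(\tau_i-\tau_{i-1})\times(\tau_k-\tau_{k-1})}$, $1\le i\le m$, $1\le k\le m-j+1$, one has: $R^{(1)}_{ii}=I_{\tau_i-\tau_{i-1}}$ for $1\le i\le m$; $R^{(1)}_{ik}=0$ for $1\le i<k\le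 m$; and $R^{(j)}_{ik}=0$ for $2\le j\le m$, $1\le i\le m$, $\max\{i-j+1,1\}\le k\le m-j+1$. The uniqueness asserts that exactly one such $R$ is $\widetilde C_W$-equivalent to $P$. *)

theory Defs
  imports
    "Jordan_Normal_Form.Matrix"
    "Jordan_Normal_Form.DL_Rank"
begin

text \<open>
  A Weyr characteristic \<open>(w_1, ..., w_m)\<close> is the list \<open>ws\<close> and \<open>(r_1, ..., r_k)\<close> is the list \<open>rs\<close>.
  Matrix entries, and hence the row and column indices occurring in index sequences, count from
  \<open>0\<close>; the numbers of blocks (\<open>i\<close>, \<open>j\<close>, \<open>k\<close> below) count from \<open>1\<close>, so \<open>w_j\<close> is \<open>ws ! (j - 1)\<close>.
\<close>

text \<open>\<open>A(I, J)\<close>, rows and columns taken in the listed order.\<close>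
definition sub_mat :: "'a mat \<Rightarrow> nat list \<Rightarrow> nat list \<Rightarrow> 'a mat" where
  "sub_mat A I J = mat (length I) (length J) (\<lambda>(a, b). A $$ (I ! a, J ! b))"

text \<open>\<open>I_{p,q}\<close>, for \<open>p \<ge> q\<close>.\<close>
definition rect_id :: "nat \<Rightarrow> nat \<Rightarrow> real mat" where
  "rect_id p q = 1\<^sub>m q @\<^sub>r 0\<^sub>m (p - q) q"

text \<open>
  In the last equation the upper right block is the block row
  \<open>[I_{w,v} 0]\<close>, padded to the width \<open>v + sum_list ws\<close>.
\<close>
fun weyr_mat :: "real \<Rightarrow> nat list \<Rightarrow> real mat" where
  "weyr_mat l [] = 0\<^sub>m 0 0"
| "weyr_mat l [w] = l \<cdot>\<^sub>m 1\<^sub>m w"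
| "weyr_mat l (w # v # ws) =
     four_block_mat
       (l \<cdot>\<^sub>m 1\<^sub>m w)
       (four_block_mat (rect_id w v) (0\<^sub>m w (sum_list ws))
                       (0\<^sub>m 0 v)      (0\<^sub>m 0 (sum_list ws)))
       (0\<^sub>m (v + sum_list ws) w)
       (weyr_mat l (v # ws))"

text \<open>\<open>\<tau>_0 = 0\<close> and \<open>\<tau>_i = w_{m-i+1}\<close> for \<open>1 \<le> i \<le> m\<close>.\<close>
definition tau :: "nat list \<Rightarrow> nat \<Rightarrow> nat" where
  "tau ws i = (if i = 0 then 0 else ws ! (length ws - i))"

definition stack_rows :: "nat \<Rightarrow> 'a :: zero mat list \<Rightarrow> 'a mat" where
  "stack_rows c Bs = foldr (@\<^sub>r) Bs (0\<^sub>m 0 c)"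

text \<open>Here \<open>i\<close> is zero-based: the list entry at \<open>i\<close> is \<open>P_{i+1}\<close>, the first \<open>r_{i+1}\<close> rows of \<open>P_1 W^i\<close>.\<close>
definition P_mats :: "real mat \<Rightarrow> nat list \<Rightarrow> real mat set" where
  "P_mats W rs =
     {P. \<exists>P1 \<in> carrier_mat (rs ! 0) (dim_row W).
           P = stack_rows (dim_row W)
                 (map (\<lambda>i. sub_mat (P1 * W ^\<^sub>m i) [0..<rs ! i] [0..<dim_row W]) [0..<length rs])
         \<and> vec_space.rank (dim_row P) P = dim_row W}"

definition centralizer :: "real mat \<Rightarrow> real mat set" where
  "centralizer W =
     {X \<in> carrier_mat (dim_row W) (dim_row W). invertible_mat X \<and> X * W = W * X}"

definition C_equiv :: "real mat \<Rightarrow> real mat \<Rightarrow> real mat \<Rightarrow> bool" where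
  "C_equiv W P P' \<longleftrightarrow> (\<exists>X \<in> centralizer W. P' = P * X)"

text \<open>\<open>Q_{l,p}\<close>, with entries in \<open>{0, ..., p - 1}\<close>.\<close>
definition Q_seqs :: "nat \<Rightarrow> nat \<Rightarrow> nat list set" where
  "Q_seqs l p = {J. length J = l \<and> sorted_wrt (<) J \<and> set J \<subseteq> {0..<p}}"

text \<open>The member \<open>\<I>_j\<close> of \<open>(\<I>_1, ..., \<I>_m)\<close>, with \<open>\<I>_0\<close> empty.\<close>
definition idx_seq :: "nat list list \<Rightarrow> nat \<Rightarrow> nat list" where
  "idx_seq Is j = (if j = 0 then [] else Is ! (j - 1))"

definition admissible :: "nat list \<Rightarrow> nat \<Rightarrow> real mat \<Rightarrow> nat list list \<Rightarrow> bool" where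
  "admissible ws r P Is \<longleftrightarrow>
     length Is = length ws \<and>
     (\<forall>j \<in> {1..length ws}.
        length (idx_seq Is j) = tau ws j \<and>
        distinct (idx_seq Is j) \<and>
        set (idx_seq Is j) \<subseteq> {0..<r} \<and>
        (\<exists>J \<in> Q_seqs (tau ws j - tau ws (j - 1)) r. idx_seq Is j = idx_seq Is (j - 1) @ J) \<and>
        invertible_mat (sub_mat P (idx_seq Is j) [0..<tau ws j]))"

text \<open>\<open>R_{1j}\<close>: the first \<open>r\<close> rows of \<open>R\<close> and the \<open>w_j\<close> columns of its \<open>j\<close>-th block column.\<close>
definition first_block :: "nat list \<Rightarrow> nat \<Rightarrow> real mat \<Rightarrow> nat \<Rightarrow> real mat" where
  "first_block ws r R j =
     sub_mat R [0..<r] [sum_list (take (j - 1) ws)..<sum_list (take j ws)]"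

text \<open>\<open>R^{(j)}_{ik}\<close>: the \<open>(i, k)\<close> block of \<open>R_{1j}(\<I>_m, :)\<close> for the partition by the \<open>\<tau>_i\<close>.\<close>
definition tau_block ::
  "nat list \<Rightarrow> nat \<Rightarrow> nat list list \<Rightarrow> real mat \<Rightarrow> nat \<Rightarrow> nat \<Rightarrow> nat \<Rightarrow> real mat" where
  "tau_block ws r Is R j i k =
     sub_mat
       (sub_mat (first_block ws r R j) (idx_seq Is (length ws)) [0..<ws ! (j - 1)])
       [tau ws (i - 1)..<tau ws i] [tau ws (k - 1)..<tau ws k]"

text \<open>
  The lower bound \<open>max (i + 1 - j) 1\<close> is \<open>max{i - j + 1, 1}\<close>: truncation of the subtraction at \<open>0\<close>
  has no effect on the maximum.
\<close>
definition reduced_form ::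
  "real \<Rightarrow> nat list \<Rightarrow> nat list \<Rightarrow> nat list list \<Rightarrow> real mat \<Rightarrow> bool" where
  "reduced_form l ws rs Is R \<longleftrightarrow>
     (let m = length ws;
          r = rs ! 0;
          B = tau_block ws r Is R;
          d = (\<lambda>i. tau ws i - tau ws (i - 1))
      in R \<in> P_mats (weyr_mat l ws) rs \<and>
         (\<forall>i \<in> {1..m}. B 1 i i = 1\<^sub>m (d i)) \<and>
         (\<forall>i \<in> {1..m}. \<forall>k \<in> {i<..m}. B 1 i k = 0\<^sub>m (d i) (d k)) \<and>
         (\<forall>j \<in> {2..m}. \<forall>i \<in> {1..m}. \<forall>k \<in> {max (i + 1 - j) 1..m + 1 - j}.
            B j i k = 0\<^sub>m (d i) (d k)))"

end

theory Submission
  imports Defs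
begin

text \<open>
  Index the columns by pairs \<open>(i, a)\<close> with \<open>a < w_i\<close>. A matrix \<open>X\<close> commutes with \<open>W\<close> iff its
  entries form a block Toeplitz pattern \<open>F a (j - i) b\<close> in which \<open>F a j b\<close> vanishes when column \<open>b\<close>
  meets more than \<open>j\<close> blocks more than column \<open>a\<close>. The positions \<open>(a, j, b)\<close> where \<open>F\<close> is free are
  exactly the positions where a reduced form prescribes the entries of \<open>R = P X\<close>. For fixed \<open>b\<close> these
  prescriptions are solved recursively in \<open>j\<close>: the unknowns \<open>F a j b\<close> enter through one of the matrices
  \<open>P(\<I>_t, 1:\<tau>_t)\<close>, which are invertible by admissibility, and all other terms involve smaller \<open>j\<close>.
  Hence exactly one such \<open>X\<close> exists.
\<close>

section \<open>Columns of a Weyr partition\<close>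

text \<open>The number of blocks having a column of index \<open>a\<close>; blocks are counted from \<open>0\<close> here.\<close>
definition height :: "nat list \<Rightarrow> nat \<Rightarrow> nat" where
  "height ws a = length (takeWhile (\<lambda>w. a < w) ws)"

text \<open>With blocks counted from \<open>0\<close>, column \<open>b\<close> of block
  \<open>j\<close> sits at position \<open>off ws j + b\<close>. For sorted \<open>ws\<close>, the
  pairs \<open>(j, b)\<close> with \<open>j < height ws b\<close> are coordinates for all
  positions.\<close>

definition off :: "nat list \<Rightarrow> nat \<Rightarrow> nat" where
  "off ws j = sum_list (take j ws)"

lemma off_0 [simp]: "off ws 0 = 0"
  by (simp add: off_def)

lemma off_Cons_Suc [simp]: "off (w # ws) (Suc j) = w + off ws j"
  by (simp add: off_def)

text \<open>Weakly decreasing sizes make the blocks that reach column \<open>a\<close> an initial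
  segment, so \<open>takeWhile\<close> finds all of them; \<open>height\<close> is the conjugate
  partition of \<open>ws\<close>.\<close>

lemma less_height_iff:
  assumes "sorted_wrt (\<ge>) ws"
  shows "i < height ws a \<longleftrightarrow> i < length ws \<and> a < ws ! i"
  using assms
proof (induction ws arbitrary: i)
  case (Cons w ws)
  show ?case
  proof (cases i)
    case (Suc k)
    with Cons show ?thesis
      by (auto simp: height_def) (meson nth_mem order_le_less_trans not_less)
  qed (auto simp: height_def)
qed (auto simp: height_def)

lemma height_le_length: "height ws a \<le> length ws"
  by (simp add: height_def length_takeWhile_le)

lemma height_antimono:
  assumes "sorted_wrt (\<ge>) ws" and "a \<le> b"
  shows "height ws b \<le> height ws a"
  using less_height_iff[OF assms(1)] assms(2) by (metis leI less_irrefl order_le_less_trans)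

lemma off_add_less:
  assumes "i < length ws" and "a < ws ! i"
  shows "off ws i + a < sum_list ws"
  using assms
proof (induction ws arbitrary: i)
  case (Cons w ws)
  then show ?case by (cases i) auto
qed auto

lemma off_cases:
  assumes "p < sum_list ws"
  obtains i a where "i < length ws" and "a < ws ! i" and "p = off ws i + a"
  using assms
proof (induction ws arbitrary: p thesis)
  case (Cons w ws)
  show ?case
  proof (cases "p < w")
    case True
    then show ?thesis using Cons.prems(1)[of 0 p] by simp
  next
    case False
    then have "p - w < sum_list ws" using Cons.prems(2) by simp
    then obtain i a where "i < length ws" "a < ws ! i" "p - w = off ws i + a"
      using Cons.IH by blast
    then show ?thesis using Cons.prems(1)[of "Suc i" a] False by simp
  qed
qed auto

lemma off_add_inj:
  assumes "i < length ws" "a < ws ! i" "j < length ws" "b < ws ! j"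
    and "off ws i + a = off ws j + b"
  shows "i = j \<and> a = b"
  using assms
proof (induction ws arbitrary: i j)
  case (Cons w ws)
  show ?case
  proof (cases i)
    case 0
    then show ?thesis using Cons.prems by (cases j) auto
  next
    case (Suc k)
    then show ?thesis using Cons.prems Cons.IH by (cases j) auto
  qed
qed auto

lemma sum_blocks:
  fixes f :: "nat \<Rightarrow> 'a :: comm_monoid_add"
  shows "(\<Sum>p<sum_list ws. f p) = (\<Sum>i<length ws. \<Sum>a<ws ! i. f (off ws i + a))"
proof (induction ws arbitrary: f)
  case (Cons w ws)
  have "(\<Sum>p<w + n. f p) = (\<Sum>p<w. f p) + (\<Sum>p<n. f (w + p))" for n
    by (induction n) (simp_all add: add.assoc)
  then show ?case
    by (simp add: Cons.IH sum.lessThan_Suc_shift add.assoc del: sum.lessThan_Suc)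
qed simp

lemma less_heightD:
  assumes "sorted_wrt (\<ge>) ws" and "i < height ws a"
  shows "i < length ws" and "a < ws ! i"
  using assms less_height_iff by blast+

section \<open>Entries of the Weyr matrix in pair coordinates\<close>

lemma weyr_mat_carrier: "weyr_mat l ws \<in> carrier_mat (sum_list ws) (sum_list ws)"
  by (induction l ws rule: weyr_mat.induct) (auto simp: rect_id_def)

lemma rect_id_index:
  assumes "v \<le> w" "a < w" "b < v"
  shows "rect_id w v $$ (a, b) = (if a = b then 1 else 0)"
  using assms by (auto simp: rect_id_def append_rows_def)

lemma rect_id_carrier:
  assumes "v \<le> w"
  shows "rect_id w v \<in> carrier_mat w v"
  using assms by (auto simp: rect_id_def append_rows_def)

text \<open>Each \<open>rect_id\<close> joins column \<open>a\<close> of one block to column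
  \<open>a\<close> of the next, so the positions \<open>(0, a), (1, a), ...\<close> form a Jordan
  chain of length \<open>height ws a\<close>.\<close>

lemma weyr_mat_index:
  assumes "sorted_wrt (\<ge>) ws" "i < length ws" "a < ws ! i" "j < length ws" "b < ws ! j"
  shows "weyr_mat l ws $$ (off ws i + a, off ws j + b) =
    (if a = b \<and> i = j then l else if a = b \<and> j = Suc i then 1 else 0)"
  using assms
proof (induction l ws arbitrary: i j rule: weyr_mat.induct)
  case (3 l w v ws)
  let ?U = "four_block_mat (rect_id w v) (0\<^sub>m w (sum_list ws)) (0\<^sub>m 0 v) (0\<^sub>m 0 (sum_list ws))"
  let ?W = "weyr_mat l (v # ws)"
  let ?s = "v + sum_list ws"
  have "v \<le> w" using 3 by simp
  note rc = rect_id_carrier[OF this]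
  have U: "?U \<in> carrier_mat w ?s" using rc by auto
  have W: "?W \<in> carrier_mat ?s ?s" using weyr_mat_carrier[of l "v # ws"] by simp
  have lt: "off (v # ws) i' + a' < ?s" if "i' < length (v # ws)" "a' < (v # ws) ! i'" for i' a'
    using off_add_less[OF that] by simp
  show ?case
  proof (cases i)
    case i: 0
    show ?thesis
    proof (cases j)
      case 0
      then show ?thesis using i 3 U W by auto
    next
      case (Suc j')
      have *: "off (v # ws) j' + b < ?s" using lt 3 Suc by auto
      then have e: "weyr_mat l (w # v # ws) $$ (off (w # v # ws) i + a, off (w # v # ws) j + b)
        = ?U $$ (a, off (v # ws) j' + b)"
        using i Suc 3(4) U W by auto
      show ?thesis
      proof (cases j')
        case 0
        then show ?thesis unfolding e using i Suc 3 rc \<open>v \<le> w\<close> by (auto simp: rect_id_index)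
      next
        case (Suc j'')
        then show ?thesis unfolding e using i \<open>j = Suc j'\<close> * rc 3(4) by auto
      qed
    qed
  next
    case (Suc i')
    have i': "off (v # ws) i' + a < ?s" using lt 3 Suc by auto
    show ?thesis
    proof (cases j)
      case 0
      then show ?thesis using Suc 3(6) i' U W by auto
    next
      case j: (Suc j')
      have j': "off (v # ws) j' + b < ?s" using lt 3 j by auto
      have "weyr_mat l (w # v # ws) $$ (off (w # v # ws) i + a, off (w # v # ws) j + b)
        = ?W $$ (off (v # ws) i' + a, off (v # ws) j' + b)"
        using i' j' Suc j U W by auto
      then show ?thesis using 3(1)[of i' j'] 3(2-) Suc j by simp
    qed
  qed
qed auto

text \<open>Two Kronecker deltas let sums over \<open>p\<close> collapse. The inner guard is there
  because, once the chain of \<open>a\<close> has ended, \<open>off ws (Suc i) + a\<close> may be a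
  position of some other pair.\<close>

lemma weyr_mat_row:
  assumes s: "sorted_wrt (\<ge>) ws" and i: "i < height ws a" and p: "p < sum_list ws"
  shows "weyr_mat l ws $$ (off ws i + a, p) =
    (if p = off ws i + a then l else 0) +
    (if p = off ws (Suc i) + a then (if Suc i < height ws a then 1 else 0) else 0)"
proof -
  obtain j b where j: "j < length ws" "b < ws ! j" "p = off ws j + b" using off_cases[OF p] .
  note ia = less_heightD[OF s i]
  have e: "off ws j + b = off ws i + a \<longleftrightarrow> a = b \<and> i = j"
    using off_add_inj[OF j(1,2) ia] by blast
  have e': "off ws j + b = off ws (Suc i) + a \<and> Suc i < height ws a \<longleftrightarrow> a = b \<and> j = Suc i"
    using off_add_inj[OF j(1,2) less_heightD[OF s]] j(1,2) less_height_iff[OF s] by blast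
  have "weyr_mat l ws $$ (off ws i + a, p) =
      (if a = b \<and> i = j then l else 0) + (if a = b \<and> j = Suc i then 1 else 0)"
    by (simp add: j(3) weyr_mat_index[OF s ia j(1,2)])
  then show ?thesis unfolding e[symmetric] e'[symmetric] j(3) by simp
qed

text \<open>The guard \<open>0 < j\<close> keeps the truncated \<open>j - 1\<close> from counting
  the diagonal position twice in the first block.\<close>

lemma weyr_mat_col:
  assumes s: "sorted_wrt (\<ge>) ws" and j: "j < height ws b" and p: "p < sum_list ws"
  shows "weyr_mat l ws $$ (p, off ws j + b) =
    (if p = off ws j + b then l else 0) +
    (if p = off ws (j - 1) + b then (if 0 < j then 1 else 0) else 0)"
proof -
  obtain i a where i: "i < length ws" "a < ws ! i" "p = off ws i + a" using off_cases[OF p] .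
  note jb = less_heightD[OF s j]
  have "j - 1 < height ws b" using j by simp
  note jb' = less_heightD[OF s this]
  have e: "off ws i + a = off ws j + b \<longleftrightarrow> a = b \<and> i = j"
    using off_add_inj[OF i(1,2) jb] by blast
  have e': "off ws i + a = off ws (j - 1) + b \<and> 0 < j \<longleftrightarrow> a = b \<and> j = Suc i"
    using off_add_inj[OF i(1,2) jb'] by auto
  have "weyr_mat l ws $$ (p, off ws j + b) =
      (if a = b \<and> i = j then l else 0) + (if a = b \<and> j = Suc i then 1 else 0)"
    by (simp add: i(3) weyr_mat_index[OF s i(1,2) jb])
  then show ?thesis unfolding e[symmetric] e'[symmetric] i(3) by simp
qed

section \<open>The centralizer\<close>

text \<open>\<open>F a d b\<close> is the common entry at all block positions
  \<open>(i, i + d)\<close>. The last clause concerns the end of the chain of \<open>a\<close>,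
  where a shift along the block diagonal leaves the chain; \<open>0 < height ws a\<close> restricts
  it to columns that exist.\<close>

definition weyr_toeplitz :: "nat list \<Rightarrow> (nat \<Rightarrow> nat \<Rightarrow> nat \<Rightarrow> real) \<Rightarrow> real mat \<Rightarrow> bool" where
  "weyr_toeplitz ws F X \<longleftrightarrow>
     X \<in> carrier_mat (sum_list ws) (sum_list ws) \<and>
     (\<forall>i a j b. i < height ws a \<longrightarrow> j < height ws b \<longrightarrow>
        X $$ (off ws i + a, off ws j + b) = (if i \<le> j then F a (j - i) b else 0)) \<and>
     (\<forall>a j b. 0 < height ws a \<longrightarrow> height ws a + j < height ws b \<longrightarrow> F a j b = 0)"

text \<open>The multiples of \<open>l\<close> cancel and the nilpotent part remains: on the left it
  moves the row to the next block, on the right it moves the column to the previous block, with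
  \<open>0\<close> at the ends of the chains.\<close>

lemma commutes_weyr_mat_iff:
  assumes s: "sorted_wrt (\<ge>) ws" and X: "X \<in> carrier_mat (sum_list ws) (sum_list ws)"
  shows "X * weyr_mat l ws = weyr_mat l ws * X \<longleftrightarrow>
    (\<forall>i a j b. i < height ws a \<longrightarrow> j < height ws b \<longrightarrow>
      (if Suc i < height ws a then X $$ (off ws (Suc i) + a, off ws j + b) else 0) =
      (if 0 < j then X $$ (off ws i + a, off ws (j - 1) + b) else 0))"
    (is "?L \<longleftrightarrow> ?R")
proof -
  let ?W = "weyr_mat l ws" and ?s = "sum_list ws"
  have W: "dim_row ?W = ?s" "dim_col ?W = ?s" 
    using carrier_matD[OF weyr_mat_carrier[of l ws]] .
  have WX: "(?W * X) $$ (off ws i + a, q) = l * X $$ (off ws i + a, q) +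
      (if Suc i < height ws a then X $$ (off ws (Suc i) + a, q) else 0)"
    if i: "i < height ws a" and q: "q < ?s" for i a q
  proof -
    note lt = off_add_less[OF less_heightD[OF s i]]
    have lt': "off ws (Suc i) + a < ?s" if "Suc i < height ws a"
      using off_add_less[OF less_heightD[OF s that]] .
    have "(?W * X) $$ (off ws i + a, q) = (\<Sum>p<?s. ?W $$ (off ws i + a, p) * X $$ (p, q))"
      using X W lt q by (simp add: scalar_prod_def atLeast0LessThan)
    also have "\<dots> = (\<Sum>p<?s. (if p = off ws i + a then l * X $$ (p, q) else 0) +
        (if p = off ws (Suc i) + a then (if Suc i < height ws a then X $$ (p, q) else 0) else 0))"
      by (rule sum.cong[OF refl], subst weyr_mat_row[OF s i]) (auto simp: distrib_right)
    also have "\<dots> = l * X $$ (off ws i + a, q) +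
      (if Suc i < height ws a then X $$ (off ws (Suc i) + a, q) else 0)"
      using lt lt' by (simp add: sum.distrib sum.delta)
    finally show ?thesis .
  qed
  have XW: "(X * ?W) $$ (q, off ws j + b) = l * X $$ (q, off ws j + b) +
      (if 0 < j then X $$ (q, off ws (j - 1) + b) else 0)"
    if j: "j < height ws b" and q: "q < ?s" for j b q
  proof -
    note lt = off_add_less[OF less_heightD[OF s j]]
    have "j - 1 < height ws b" using j by simp
    note lt' = off_add_less[OF less_heightD[OF s this]]
    have "(X * ?W) $$ (q, off ws j + b) = (\<Sum>p<?s. X $$ (q, p) * ?W $$ (p, off ws j + b))"
      using X W lt q by (simp add: scalar_prod_def atLeast0LessThan)
    also have "\<dots> = (\<Sum>p<?s. (if p = off ws j + b then l * X $$ (q, p) else 0) +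
        (if p = off ws (j - 1) + b then (if 0 < j then X $$ (q, p) else 0) else 0))"
      by (rule sum.cong[OF refl], subst weyr_mat_col[OF s j]) (auto simp: distrib_left)
    also have "\<dots> = l * X $$ (q, off ws j + b) +
      (if 0 < j then X $$ (q, off ws (j - 1) + b) else 0)"
      using lt lt' by (simp add: sum.distrib sum.delta)
    finally show ?thesis .
  qed
  have off_lt: "off ws i + a < ?s" if "i < height ws a" for i a
    using off_add_less[OF less_heightD[OF s that]] .
  show ?thesis
  proof
    assume ?L
    then show ?R using WX XW off_lt by (smt (verit, best))
  next
    assume R: ?R
    show ?L
    proof (rule eq_matI)
      fix p q assume "p < dim_row (?W * X)" "q < dim_col (?W * X)"
      then have pq: "p < ?s" "q < ?s" using X W by auto
      obtain i a where i: "i < length ws" "a < ws ! i" "p = off ws i + a" using off_cases[OF pq(1)] .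
      obtain j b where j: "j < length ws" "b < ws ! j" "q = off ws j + b" using off_cases[OF pq(2)] .
      have ia: "i < height ws a" and jb: "j < height ws b"
        using i j less_height_iff[OF s] by auto
      show "(X * ?W) $$ (p, q) = (?W * X) $$ (p, q)"
        using WX[OF ia pq(2)] XW[OF jb pq(1)] R[rule_format, OF ia jb]
        unfolding i(3) j(3) by (simp only:)
    qed (use X W in auto)
  qed
qed

lemma commutes_imp_weyr_toeplitz:
  assumes s: "sorted_wrt (\<ge>) ws" and X: "X \<in> carrier_mat (sum_list ws) (sum_list ws)"
    and comm: "X * weyr_mat l ws = weyr_mat l ws * X"
  shows "weyr_toeplitz ws (\<lambda>a j b. X $$ (a, off ws j + b)) X"
proof -
  have C: "(if Suc i < height ws a then X $$ (off ws (Suc i) + a, off ws j + b) else 0) =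
      (if 0 < j then X $$ (off ws i + a, off ws (j - 1) + b) else 0)"
    if "i < height ws a" "j < height ws b" for i a j b
    using commutes_weyr_mat_iff[OF s X, of l] comm that by blast
  have E: "X $$ (off ws i + a, off ws j + b) = (if i \<le> j then X $$ (a, off ws (j - i) + b) else 0)"
    if "i < height ws a" "j < height ws b" for i a j b
    using that
  proof (induction i arbitrary: j)
    \<comment> \<open>\<open>C\<close> leads back along the block diagonal from
      \<open>(Suc i, j)\<close> to \<open>(i, j - 1)\<close>; for \<open>j = 0\<close> it makes the
      entry vanish.\<close>
    case (Suc i)
    then show ?case using C[of i a j b] Suc.IH[of "j - 1"] by auto
  qed simp
  have Z: "X $$ (a, off ws j + b) = 0"
    if a: "0 < height ws a" and h: "height ws a + j < height ws b" for a j b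
  proof -
    \<comment> \<open>In the last block containing column \<open>a\<close> the left side of
      \<open>C\<close> is \<open>0\<close>, which kills the entry at blocks
      \<open>(i, i + j)\<close> and, by \<open>E\<close>, the one at \<open>(0, j)\<close>.\<close>
    define i where "i = height ws a - 1"
    have i: "i < height ws a" "\<not> Suc i < height ws a" using a by (auto simp: i_def)
    have "X $$ (off ws i + a, off ws (i + j) + b) = 0"
      using C[of i a "Suc (i + j)" b] i h by auto
    then show ?thesis using E[of i a "i + j" b] i h by auto
  qed
  show ?thesis unfolding weyr_toeplitz_def using X E Z by blast
qed

lemma weyr_toeplitz_imp_commutes:
  assumes s: "sorted_wrt (\<ge>) ws" and T: "weyr_toeplitz ws F X"
  shows "X * weyr_mat l ws = weyr_mat l ws * X"
proof -
  have X: "X \<in> carrier_mat (sum_list ws) (sum_list ws)"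
    and E: "\<And>i a j b. i < height ws a \<Longrightarrow> j < height ws b \<Longrightarrow>
      X $$ (off ws i + a, off ws j + b) = (if i \<le> j then F a (j - i) b else 0)"
    and Z: "\<And>a j b. 0 < height ws a \<Longrightarrow> height ws a + j < height ws b \<Longrightarrow> F a j b = 0"
    using T unfolding weyr_toeplitz_def by blast+
  show ?thesis
    unfolding commutes_weyr_mat_iff[OF s X]
  proof (intro allI impI)
    fix i a j b assume i: "i < height ws a" and j: "j < height ws b"
    show "(if Suc i < height ws a then X $$ (off ws (Suc i) + a, off ws j + b) else 0) =
      (if 0 < j then X $$ (off ws i + a, off ws (j - 1) + b) else 0)"
      using E[of "Suc i" a j b] E[of i a "j - 1" b] Z[of a "j - 1 - i" b] i j
      by (cases j) auto
  qed
qed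

text \<open>Block triangularity cuts the product off at \<open>i = j\<close>, and the Toeplitz shape
  makes it a convolution in the block index. Only values of \<open>F\<close> with last argument
  \<open>b\<close> occur, so the systems for different \<open>b\<close> decouple.\<close>

lemma mult_weyr_toeplitz_index:
  assumes s: "sorted_wrt (\<ge>) ws" and T: "weyr_toeplitz ws F X"
    and P: "P \<in> carrier_mat n (sum_list ws)" and "c < n" and j: "j < height ws b"
  shows "(P * X) $$ (c, off ws j + b) =
    (\<Sum>i\<le>j. \<Sum>a<ws ! i. P $$ (c, off ws i + a) * F a (j - i) b)"
proof -
  have X: "X \<in> carrier_mat (sum_list ws) (sum_list ws)"
    and E: "\<And>i a. i < height ws a \<Longrightarrow>
      X $$ (off ws i + a, off ws j + b) = (if i \<le> j then F a (j - i) b else 0)"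
    using T j unfolding weyr_toeplitz_def by blast+
  have jb: "j < length ws" "b < ws ! j" using less_heightD[OF s j] .
  have "(P * X) $$ (c, off ws j + b) =
      (\<Sum>p<sum_list ws. P $$ (c, p) * X $$ (p, off ws j + b))"
    using X P \<open>c < n\<close> off_add_less[OF jb] by (simp add: scalar_prod_def atLeast0LessThan)
  also have "\<dots> = (\<Sum>i<length ws. \<Sum>a<ws ! i.
      P $$ (c, off ws i + a) * (if i \<le> j then F a (j - i) b else 0))"
    unfolding sum_blocks
    by (intro sum.cong refl) (simp add: E less_height_iff[OF s])
  also have "\<dots> = (\<Sum>i\<le>j. \<Sum>a<ws ! i. P $$ (c, off ws i + a) * F a (j - i) b)"
    by (rule sum.mono_neutral_cong_right) (use jb in auto)
  finally show ?thesis .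
qed

section \<open>Linear algebra\<close>

lemma invertible_mat_iff_det:
  fixes A :: "'a :: field mat"
  assumes A: "A \<in> carrier_mat n n"
  shows "invertible_mat A \<longleftrightarrow> det A \<noteq> 0"
proof
  assume "invertible_mat A"
  then obtain B where "A * B = 1\<^sub>m (dim_row A)" and BA: "B * A = 1\<^sub>m (dim_row B)"
    unfolding invertible_mat_def inverts_mat_def by blast
  then have AB: "A * B = 1\<^sub>m n" and "dim_col B = n" using A by (auto dest: arg_cong[of _ _ dim_col])
  moreover have "dim_row B = n" using arg_cong[OF BA, of dim_col] A by simp
  ultimately have "det A * det B = 1" using det_mult[of A n B] A by auto
  then show "det A \<noteq> 0" by auto
next
  assume "det A \<noteq> 0"
  then obtain B where "B \<in> carrier_mat n n" "A * B = 1\<^sub>m n" "B * A = 1\<^sub>m n"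
    using det_non_zero_imp_unit[OF A, of "()"]
    by (auto simp: Units_def ring_mat_def)
  then show "invertible_mat A" using A unfolding invertible_mat_def inverts_mat_def by auto
qed

lemma invertible_mat_inverse:
  fixes A :: "'a :: field mat"
  assumes A: "A \<in> carrier_mat n n" and "invertible_mat A"
  obtains B where "B \<in> carrier_mat n n" "A * B = 1\<^sub>m n" "B * A = 1\<^sub>m n"
  using assms det_non_zero_imp_unit[OF A, of "()"] invertible_mat_iff_det[OF A]
  by (auto simp: Units_def ring_mat_def)

lemma invertible_mat_solve:
  fixes A :: "'a :: field mat"
  assumes A: "A \<in> carrier_mat n n" and "invertible_mat A"
  shows "\<exists>x. \<forall>c<n. (\<Sum>a<n. A $$ (c, a) * x a) = y c"
proof -
  obtain B where B: "B \<in> carrier_mat n n" and AB: "A * B = 1\<^sub>m n"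
    using invertible_mat_inverse[OF assms] .
  define v where "v = B *\<^sub>v vec n y"
  have v: "v \<in> carrier_vec n" using B by (simp add: v_def)
  have "A *\<^sub>v v = vec n y"
    unfolding v_def using A B AB by (subst assoc_mult_mat_vec[symmetric, of _ n n _ n]) auto
  then have "(A *\<^sub>v v) $ c = y c" if "c < n" for c
    using that by simp
  then have "(\<Sum>a<n. A $$ (c, a) * v $ a) = y c" if "c < n" for c
    using that A v by (simp add: scalar_prod_def atLeast0LessThan)
  then show ?thesis by blast
qed

lemma invertible_mat_kernel:
  fixes A :: "'a :: field mat"
  assumes A: "A \<in> carrier_mat n n" and "invertible_mat A"
    and x: "\<And>c. c < n \<Longrightarrow> (\<Sum>a<n. A $$ (c, a) * x a) = 0" and "a < n"
  shows "x a = 0"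
proof (rule ccontr)
  assume "x a \<noteq> 0"
  have "A *\<^sub>v vec n x = 0\<^sub>v n"
    using A x by (intro eq_vecI) (simp_all add: scalar_prod_def atLeast0LessThan)
  moreover have "vec n x \<noteq> 0\<^sub>v n"
    using \<open>x a \<noteq> 0\<close> \<open>a < n\<close> by (metis index_vec index_zero_vec(1))
  ultimately have "det A = 0"
    using det_0_iff_vec_prod_zero[OF A] vec_carrier by blast
  then show False using assms invertible_mat_iff_det by blast
qed

text \<open>The column spaces coincide: a right factor can only shrink the column space, and this
  applies both to \<open>X\<close> and to its inverse.\<close>

lemma rank_mult_invertible:
  fixes A X :: "'a :: field mat"
  assumes A: "A \<in> carrier_mat n s" and X: "X \<in> carrier_mat s s" and "invertible_mat X"
  shows "vec_space.rank n (A * X) = vec_space.rank n A"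
proof -
  interpret vec_space "TYPE('a)" n .
  obtain Y where Y: "Y \<in> carrier_mat s s" and XY: "X * Y = 1\<^sub>m s"
    using invertible_mat_inverse[OF X assms(3)] .
  have sub: "col_space (B * Z) \<subseteq> col_space B"
    if B: "B \<in> carrier_mat n s" and Z: "Z \<in> carrier_mat s s" for B Z
  proof
    fix y assume "y \<in> col_space (B * Z)"
    then obtain x where x: "x \<in> carrier_vec s" "y = (B * Z) *\<^sub>v x" "y \<in> carrier_vec n"
      using B Z col_space_eq[of "B * Z" s] by auto
    then have "y = B *\<^sub>v (Z *\<^sub>v x)" using B Z by (simp add: assoc_mult_mat_vec)
    then show "y \<in> col_space B"
      using x B Z col_space_eq[OF B] by (auto intro!: bexI[of _ "Z *\<^sub>v x"])
  qed
  have "A * X * Y = A" using assoc_mult_mat[OF A X Y] A XY by simp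
  then have "col_space (A * X) = col_space A"
    using sub[OF A X] sub[of "A * X" Y] A X Y by auto
  then show ?thesis by (simp add: rank_def col_space_def)
qed

section \<open>Stacked matrices and the action of the centralizer\<close>

lemma append_rows_mult:
  fixes X :: "'a :: semiring_0 mat"
  assumes "A \<in> carrier_mat n1 c" "B \<in> carrier_mat n2 c" "X \<in> carrier_mat c d"
  shows "(A @\<^sub>r B) * X = (A * X) @\<^sub>r (B * X)"
  using assms by (intro eq_matI) (auto simp: append_rows_def scalar_prod_def)

lemma stack_rows_carrier:
  assumes "\<And>B. B \<in> set Bs \<Longrightarrow> dim_col B = c"
  shows "stack_rows c Bs \<in> carrier_mat (sum_list (map dim_row Bs)) c"
  using assms
proof (induction Bs)
  case (Cons B Bs)
  then have "B @\<^sub>r stack_rows c Bs \<in> carrier_mat (dim_row B + sum_list (map dim_row Bs)) c"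
    by (intro carrier_append_rows) auto
  then show ?case by (simp add: stack_rows_def)
qed (simp add: stack_rows_def)

lemma stack_rows_mult:
  fixes X :: "'a :: semiring_0 mat"
  assumes X: "X \<in> carrier_mat c d" and "\<And>B. B \<in> set Bs \<Longrightarrow> dim_col B = c"
  shows "stack_rows c Bs * X = stack_rows d (map (\<lambda>B. B * X) Bs)"
  using assms(2)
proof (induction Bs)
  case Nil
  then show ?case using X by (auto simp: stack_rows_def)
next
  case (Cons B Bs)
  have "stack_rows c (B # Bs) * X = (B @\<^sub>r stack_rows c Bs) * X"
    by (simp add: stack_rows_def)
  also have "\<dots> = (B * X) @\<^sub>r (stack_rows c Bs * X)"
    using append_rows_mult[OF _ stack_rows_carrier X, of B "dim_row B" Bs] Cons.prems by auto
  finally show ?case using Cons by (simp add: stack_rows_def)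
qed

lemma sub_mat_mult:
  fixes X :: "'a :: semiring_0 mat"
  assumes "A \<in> carrier_mat r c" "q \<le> r" "X \<in> carrier_mat c d"
  shows "sub_mat A [0..<q] [0..<c] * X = sub_mat (A * X) [0..<q] [0..<d]"
  using assms by (intro eq_matI) (auto simp: sub_mat_def scalar_prod_def)

lemma pow_mat_commute:
  fixes W X :: "'a :: semiring_1 mat"
  assumes W: "W \<in> carrier_mat n n" and X: "X \<in> carrier_mat n n" and c: "X * W = W * X"
  shows "X * W ^\<^sub>m i = W ^\<^sub>m i * X"
proof (induction i)
  case (Suc i)
  have Wi: "W ^\<^sub>m i \<in> carrier_mat n n" using W by simp
  have "X * (W ^\<^sub>m i * W) = X * W ^\<^sub>m i * W"
    by (rule assoc_mult_mat[OF X Wi W, symmetric])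
  also have "\<dots> = W ^\<^sub>m i * (X * W)" unfolding Suc by (rule assoc_mult_mat[OF Wi X W])
  also have "\<dots> = W ^\<^sub>m i * W * X" unfolding c by (rule assoc_mult_mat[OF Wi W X, symmetric])
  finally show ?case by simp
qed (use W X in simp)

lemma P_mats_carrier:
  assumes "P \<in> P_mats W rs"
  shows "P \<in> carrier_mat (sum_list rs) (dim_row W)"
proof -
  obtain P1 where P: "P = stack_rows (dim_row W)
      (map (\<lambda>i. sub_mat (P1 * W ^\<^sub>m i) [0..<rs ! i] [0..<dim_row W]) [0..<length rs])"
      (is "P = stack_rows _ ?Bs")
    using assms unfolding P_mats_def by blast
  have "map dim_row ?Bs = rs"
    by (rule nth_equalityI) (simp_all add: sub_mat_def)
  moreover have "dim_col B = dim_row W" if "B \<in> set ?Bs" for B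
    using that by (auto simp: sub_mat_def)
  ultimately show ?thesis using stack_rows_carrier[of ?Bs "dim_row W"] unfolding P by metis
qed

text \<open>\<open>P1 * X\<close> serves as the new first block: \<open>X\<close> commutes with the
  powers of \<open>W\<close>, and taking leading rows commutes with right multiplication.\<close>

lemma P_mats_mult_centralizer:
  assumes W: "W \<in> carrier_mat s s" and rs: "sorted_wrt (\<ge>) rs"
    and P: "P \<in> P_mats W rs" and X: "X \<in> centralizer W"
  shows "P * X \<in> P_mats W rs"
proof -
  have Xc: "X \<in> carrier_mat s s" and inv: "invertible_mat X" and comm: "X * W = W * X"
    using X W by (auto simp: centralizer_def)
  obtain P1 where P1: "P1 \<in> carrier_mat (rs ! 0) s"
    and Pdef: "P = stack_rows s (map (\<lambda>i. sub_mat (P1 * W ^\<^sub>m i) [0..<rs ! i] [0..<s]) [0..<length rs])"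
    and rk: "vec_space.rank (dim_row P) P = s"
    using P W unfolding P_mats_def by auto
  have Pc: "P \<in> carrier_mat (dim_row P) s" using P_mats_carrier[OF P] W by auto
  have "sub_mat (P1 * W ^\<^sub>m i) [0..<rs ! i] [0..<s] * X =
      sub_mat (P1 * X * W ^\<^sub>m i) [0..<rs ! i] [0..<s]" if "i < length rs" for i
  proof -
    \<comment> \<open>This guarantees that the first \<open>rs ! i\<close> rows of the product with
      \<open>P1\<close> exist.\<close>
    have "rs ! i \<le> rs ! 0" using that rs by (cases i) (auto simp: sorted_wrt_iff_nth_less)
    moreover have "P1 * W ^\<^sub>m i * X = P1 * X * W ^\<^sub>m i"
      using assoc_mult_mat[OF P1 pow_carrier_mat[OF W] Xc] assoc_mult_mat[OF P1 Xc pow_carrier_mat[OF W]]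
      by (simp add: pow_mat_commute[OF W Xc comm])
    ultimately show ?thesis 
      using sub_mat_mult[OF mult_carrier_mat[OF P1 pow_carrier_mat[OF W]] _ Xc] by simp
  qed
  then have "P * X =
      stack_rows s (map (\<lambda>i. sub_mat (P1 * X * W ^\<^sub>m i) [0..<rs ! i] [0..<s]) [0..<length rs])"
    unfolding Pdef
    by (subst stack_rows_mult[OF Xc]) (auto simp: sub_mat_def intro!: arg_cong[of _ _ "stack_rows s"])
  moreover have "vec_space.rank (dim_row (P * X)) (P * X) = s"
    using rank_mult_invertible[OF Pc Xc inv] rk by simp
  moreover have "P1 * X \<in> carrier_mat (rs ! 0) s" using P1 Xc by simp
  ultimately show ?thesis using W unfolding P_mats_def by auto
qed

section \<open>Block recursion\<close>

lemma sum_atMost_split_0: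
  fixes f :: "nat \<Rightarrow> 'a :: comm_monoid_add"
  shows "(\<Sum>i\<le>n. f i) = f 0 + (\<Sum>i = 1..n. f i)"
  by (subst atMost_atLeast0, subst sum.atLeast_Suc_atMost) simp_all

text \<open>The equations at \<open>j\<close> contain \<open>f j\<close> only in the term
  \<open>i = 0\<close>; all other terms use smaller indices and go to the right-hand side. Putting
  \<open>f j a = 0\<close> for \<open>a >= N j\<close> makes the leading system square of size
  \<open>N j\<close>.\<close>

lemma block_recursion_solvable:
  fixes A :: "nat \<Rightarrow> nat \<Rightarrow> nat \<Rightarrow> 'a :: comm_ring"
  assumes "\<And>j y. j < n \<Longrightarrow> \<exists>x. \<forall>c<N j. (\<Sum>a<N j. A c 0 a * x a) = y c"
    and "\<And>j. j < n \<Longrightarrow> N j \<le> w 0"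
  shows "\<exists>f. \<forall>j<n. (\<forall>a\<ge>N j. f j a = 0) \<and>
    (\<forall>c<N j. (\<Sum>i\<le>j. \<Sum>a<w i. A c i a * f (j - i) a) = y j c)"
  using assms
proof (induction n)
  case (Suc n)
  have "\<exists>f. \<forall>j<n. (\<forall>a\<ge>N j. f j a = 0) \<and>
      (\<forall>c<N j. (\<Sum>i\<le>j. \<Sum>a<w i. A c i a * f (j - i) a) = y j c)"
    by (rule Suc.IH) (use Suc.prems in auto)
  then obtain f where f: "\<And>j a. j < n \<Longrightarrow> a \<ge> N j \<Longrightarrow> f j a = 0"
    "\<And>j c. j < n \<Longrightarrow> c < N j \<Longrightarrow> (\<Sum>i\<le>j. \<Sum>a<w i. A c i a * f (j - i) a) = y j c"
    by blast
  obtain x where x: "\<And>c. c < N n \<Longrightarrow>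
      (\<Sum>a<N n. A c 0 a * x a) = y n c - (\<Sum>i = 1..n. \<Sum>a<w i. A c i a * f (n - i) a)"
    using Suc.prems(1)[of n "\<lambda>c. y n c - (\<Sum>i = 1..n. \<Sum>a<w i. A c i a * f (n - i) a)"] by auto
  define g where "g = f(n := \<lambda>a. if a < N n then x a else 0)"
  have "(\<Sum>i\<le>n. \<Sum>a<w i. A c i a * g (n - i) a) = y n c" if c: "c < N n" for c
  proof -
    have "(\<Sum>a<w 0. A c 0 a * g n a) = (\<Sum>a<N n. A c 0 a * x a)"
      by (rule sum.mono_neutral_cong_right) (use Suc.prems(2)[of n] in \<open>auto simp: g_def\<close>)
    moreover have "(\<Sum>i = 1..n. \<Sum>a<w i. A c i a * g (n - i) a) =
        (\<Sum>i = 1..n. \<Sum>a<w i. A c i a * f (n - i) a)"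
      by (intro sum.cong refl) (auto simp: g_def)
    ultimately show ?thesis using x[OF c] by (simp add: sum_atMost_split_0)
  qed
  moreover have "(\<Sum>i\<le>j. \<Sum>a<w i. A c i a * g (j - i) a) = y j c" if "j < n" "c < N j" for j c
  proof -
    have "g (j - i) = f (j - i)" for i using that by (auto simp: g_def)
    then show ?thesis using f(2)[OF that] by simp
  qed
  moreover have "g j a = 0" if "j < Suc n" "a \<ge> N j" for j a
    using f(1)[of j a] that by (auto simp: g_def less_Suc_eq)
  ultimately show ?case by (intro exI[of _ g]) (auto simp: less_Suc_eq)
qed simp

text \<open>By strong induction the terms with \<open>i >= 1\<close> agree, so
  \<open>f j - g j\<close> lies in the kernel of the leading square system. The bound
  \<open>w i <= w 0\<close> keeps those terms in the range covered by the induction.\<close>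

lemma block_recursion_unique:
  fixes A :: "nat \<Rightarrow> nat \<Rightarrow> nat \<Rightarrow> 'a :: comm_ring"
  assumes inj: "\<And>j x a. j < n \<Longrightarrow> (\<And>c. c < N j \<Longrightarrow> (\<Sum>a<N j. A c 0 a * x a) = 0) \<Longrightarrow> a < N j \<Longrightarrow> x a = 0"
    and N: "\<And>j. j < n \<Longrightarrow> N j \<le> w 0" and w: "\<And>i. i < n \<Longrightarrow> w i \<le> w 0"
    and f0: "\<And>j a. j < n \<Longrightarrow> N j \<le> a \<Longrightarrow> a < w 0 \<Longrightarrow> f j a = 0"
    and g0: "\<And>j a. j < n \<Longrightarrow> N j \<le> a \<Longrightarrow> a < w 0 \<Longrightarrow> g j a = 0"
    and eq: "\<And>j c. j < n \<Longrightarrow> c < N j \<Longrightarrow>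
      (\<Sum>i\<le>j. \<Sum>a<w i. A c i a * f (j - i) a) = (\<Sum>i\<le>j. \<Sum>a<w i. A c i a * g (j - i) a)"
  shows "j < n \<Longrightarrow> a < w 0 \<Longrightarrow> f j a = g j a"
proof (induction j arbitrary: a rule: less_induct)
  case (less j)
  have "(\<Sum>a<N j. A c 0 a * (f j a - g j a)) = 0" if c: "c < N j" for c
  proof -
    have "(\<Sum>i = 1..j. \<Sum>a<w i. A c i a * f (j - i) a) =
        (\<Sum>i = 1..j. \<Sum>a<w i. A c i a * g (j - i) a)"
    proof (intro sum.cong refl)
      fix i a assume "i \<in> {1..j}" "a \<in> {..<w i}"
      then show "A c i a * f (j - i) a = A c i a * g (j - i) a"
        using less.IH[of "j - i" a] w[of i] less.prems by auto
    qed
    then have "(\<Sum>a<w 0. A c 0 a * f j a) = (\<Sum>a<w 0. A c 0 a * g j a)"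
      using eq[OF less.prems(1) c] by (simp add: sum_atMost_split_0)
    moreover have "(\<Sum>a<w 0. A c 0 a * f j a) = (\<Sum>a<N j. A c 0 a * f j a)"
      by (rule sum.mono_neutral_right) (use N f0 less.prems in auto)
    moreover have "(\<Sum>a<w 0. A c 0 a * g j a) = (\<Sum>a<N j. A c 0 a * g j a)"
      by (rule sum.mono_neutral_right) (use N g0 less.prems in auto)
    ultimately show ?thesis by (simp add: right_diff_distrib sum_subtractf)
  qed
  then have "f j a - g j a = 0" if "a < N j"
    using inj[of j "\<lambda>a. f j a - g j a" a] less.prems that by blast
  then show ?case using f0 g0 less.prems by (cases "a < N j") auto
qed

text \<open>
  The last nonzero block \<open>u\<close> of a kernel vector is killed by the diagonal block of \<open>X\<close>, hence by the
  lower unitriangular matrix whose entries are the sums in \<open>L\<close>.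
\<close>
lemma weyr_toeplitz_invertible:
  assumes s: "sorted_wrt (\<ge>) ws" and T: "weyr_toeplitz ws F X"
    and L: "\<And>c b. c \<le> b \<Longrightarrow> b < ws ! 0 \<Longrightarrow>
      (\<Sum>a<ws ! 0. A c a * F a 0 b) = (if c = b then 1 else 0 :: real)"
  shows "invertible_mat X"
proof (rule ccontr)
  let ?s = "sum_list ws"
  have X: "X \<in> carrier_mat ?s ?s"
    and E: "\<And>i a j b. i < height ws a \<Longrightarrow> j < height ws b \<Longrightarrow>
      X $$ (off ws i + a, off ws j + b) = (if i \<le> j then F a (j - i) b else 0)"
    and Z: "\<And>a j b. 0 < height ws a \<Longrightarrow> height ws a + j < height ws b \<Longrightarrow> F a j b = 0"
    using T unfolding weyr_toeplitz_def by blast+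
  assume "\<not> invertible_mat X"
  then obtain v where v: "v \<in> carrier_vec ?s" "v \<noteq> 0\<^sub>v ?s" "X *\<^sub>v v = 0\<^sub>v ?s"
    using det_0_iff_vec_prod_zero[OF X] invertible_mat_iff_det[OF X] by blast
  define J where "J = {j. j < length ws \<and> (\<exists>b<ws ! j. v $ (off ws j + b) \<noteq> 0)}"
  obtain p where p: "p < ?s" "v $ p \<noteq> 0" 
  proof -
    have "v = 0\<^sub>v ?s" if "\<forall>p<?s. v $ p = 0"
      using v(1) that by (intro eq_vecI) auto
    then show thesis using v(2) that by blast
  qed
  obtain k b where "k < length ws" "b < ws ! k" "p = off ws k + b" using off_cases[OF p(1)] .
  then have "k \<in> J" using p(2) by (auto simp: J_def)
  then have "J \<noteq> {}" by blast
  moreover have fin: "finite J" by (simp add: J_def)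
  ultimately have "Max J \<in> J" by (rule Max_in[rotated])
  define j where "j = Max J"
  have j: "j < length ws" using \<open>Max J \<in> J\<close> by (simp add: J_def j_def)
  obtain b0 where b0: "b0 < ws ! j" "v $ (off ws j + b0) \<noteq> 0"
    using \<open>Max J \<in> J\<close> by (auto simp: J_def j_def)
  have late: "v $ (off ws k + b) = 0" if "j < k" "k < length ws" "b < ws ! k" for k b
  proof -
    have "k \<notin> J" using Max_ge[OF fin, of k] that(1) unfolding j_def by auto
    then show ?thesis using that by (auto simp: J_def)
  qed
  have w0: "ws ! j \<le> ws ! 0" using s j by (cases j) (auto simp: sorted_wrt_iff_nth_less)
  define u where "u b = v $ (off ws j + b)" for b
  \<comment> \<open>The sums in \<open>L\<close> run over all \<open>a < ws ! 0\<close>, so the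
    relation is extended beyond the rows of block \<open>j\<close>.\<close>
  have ker: "(\<Sum>b<ws ! j. F a 0 b * u b) = 0" if a: "a < ws ! 0" for a
  proof (cases "a < ws ! j")
    case True
    then have ja: "j < height ws a" using j less_height_iff[OF s] by blast
    note lt = off_add_less[OF j True]
    have "0 = (X *\<^sub>v v) $ (off ws j + a)" using v lt by simp
    also have "\<dots> = (\<Sum>p<?s. X $$ (off ws j + a, p) * v $ p)"
      using X v(1) lt by (simp add: scalar_prod_def atLeast0LessThan)
    also have "\<dots> = (\<Sum>k<length ws. \<Sum>b<ws ! k. X $$ (off ws j + a, off ws k + b) * v $ (off ws k + b))"
      by (rule sum_blocks)
    also have "\<dots> = (\<Sum>k\<in>{j}. \<Sum>b<ws ! k. F a 0 b * u b)"
    proof (rule sum.mono_neutral_cong_right)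
      show "\<forall>k\<in>{..<length ws} - {j}.
          (\<Sum>b<ws ! k. X $$ (off ws j + a, off ws k + b) * v $ (off ws k + b)) = 0"
      proof
        fix k assume k: "k \<in> {..<length ws} - {j}"
        show "(\<Sum>b<ws ! k. X $$ (off ws j + a, off ws k + b) * v $ (off ws k + b)) = 0"
        proof (rule sum.neutral, rule ballI)
          fix b assume "b \<in> {..<ws ! k}"
          then show "X $$ (off ws j + a, off ws k + b) * v $ (off ws k + b) = 0"
            using k late[of k b] E[OF ja, of k b] less_height_iff[OF s, of k b]
            by (cases "j < k") auto
        qed
      qed
    qed (use j E[OF ja] less_height_iff[OF s] in \<open>auto simp: u_def intro!: sum.cong\<close>)
    finally show ?thesis by simp
  next
    \<comment> \<open>Block \<open>j\<close> reaches column \<open>b\<close> but not column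
      \<open>a\<close>, so \<open>F a 0 b\<close> vanishes by \<open>Z\<close>.\<close>
    case False
    have h: "0 < height ws a" using a j less_height_iff[OF s, of 0 a] by linarith
    show ?thesis
    proof (rule sum.neutral, rule ballI)
      fix b assume "b \<in> {..<ws ! j}"
      then have "height ws a + 0 < height ws b"
        using False j less_height_iff[OF s, of j a] less_height_iff[OF s, of j b] by simp
      then show "F a 0 b * u b = 0" using Z[OF h] by simp
    qed
  qed
  \<comment> \<open>At the first nonzero position \<open>c\<close> of \<open>u\<close>, the terms
    with \<open>b < c\<close> vanish and \<open>L\<close> evaluates those with
    \<open>b >= c\<close>, so row \<open>c\<close> of the product is just
    \<open>u c\<close>.\<close>
  define c where "c = (LEAST b. b < ws ! j \<and> u b \<noteq> 0)"
  have c: "c < ws ! j" "u c \<noteq> 0" and before: "\<And>b. b < c \<Longrightarrow> u b = 0"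
    using LeastI[of "\<lambda>b. b < ws ! j \<and> u b \<noteq> 0" b0] b0 not_less_Least[of _ "\<lambda>b. b < ws ! j \<and> u b \<noteq> 0"]
    unfolding c_def u_def by (auto intro: less_trans)
  have "0 = (\<Sum>a<ws ! 0. A c a * (\<Sum>b<ws ! j. F a 0 b * u b))" using ker by simp
  also have "\<dots> = (\<Sum>b<ws ! j. (\<Sum>a<ws ! 0. A c a * F a 0 b) * u b)"
    unfolding sum_distrib_left sum_distrib_right by (subst sum.swap) (simp add: mult.assoc)
  also have "\<dots> = (\<Sum>b<ws ! j. if b = c then u c else 0)"
  proof (rule sum.cong[OF refl])
    fix b assume "b \<in> {..<ws ! j}"
    then show "(\<Sum>a<ws ! 0. A c a * F a 0 b) * u b = (if b = c then u c else 0)"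
      using before[of b] L[of c b] w0 by (cases "b < c") auto
  qed
  finally show False using c by simp
qed

section \<open>Reduced forms\<close>

lemma tau_mono:
  assumes s: "sorted_wrt (\<ge>) ws" and "i \<le> k" and "k \<le> length ws"
  shows "tau ws i \<le> tau ws k"
proof (cases "i = 0 \<or> i = k")
  case False
  then show ?thesis using assms by (auto simp: tau_def sorted_wrt_iff_nth_less)
qed (auto simp: tau_def)

text \<open>For \<open>i >= 1\<close>, \<open>tau ws i\<close> is the size of block
  \<open>length ws - i\<close> counted from \<open>0\<close>, so \<open>c < tau ws i\<close> says
  that this block reaches column \<open>c\<close>, which bounds the height from below; the other
  endpoint bounds it from above.\<close>

lemma tau_interval_iff_height:
  assumes s: "sorted_wrt (\<ge>) ws" and i: "1 \<le> i" "i \<le> length ws"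
  shows "tau ws (i - 1) \<le> c \<and> c < tau ws i \<longleftrightarrow> height ws c = length ws + 1 - i"
proof -
  have "c < tau ws i \<longleftrightarrow> length ws - i < height ws c"
    using i less_height_iff[OF s, of "length ws - i" c] by (auto simp: tau_def)
  moreover have "tau ws (i - 1) \<le> c \<longleftrightarrow> height ws c \<le> length ws + 1 - i"
  \<comment> \<open>\<open>tau ws 0 = 0\<close> is a convention and no entry of \<open>ws\<close>;
    there the bound by \<open>length ws\<close> is used instead.\<close>
  proof (cases "i = 1")
    case False
    then show ?thesis
      using i less_height_iff[OF s, of "length ws + 1 - i" c] by (auto simp: tau_def)
  qed (use height_le_length[of ws c] in \<open>simp add: tau_def\<close>)
  ultimately show ?thesis using i by linarith
qed

text \<open>
  A position \<open>a\<close> lies in the \<open>i\<close>-th interval of the partition by the \<open>\<tau>_i\<close> iff its height is \<open>m + 1 - i\<close>,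
  so the conditions on the blocks \<open>R^{(j+1)}_{ik}\<close> become one inequality between heights.
\<close>
definition reduced_entries :: "nat list \<Rightarrow> nat list \<Rightarrow> real mat \<Rightarrow> bool" where
  "reduced_entries ws I R \<longleftrightarrow>
     (\<forall>c b j. c < ws ! 0 \<longrightarrow> j < height ws b \<longrightarrow> height ws b \<le> height ws c + j \<longrightarrow>
        R $$ (I ! c, off ws j + b) = (if j = 0 \<and> c = b then 1 else 0))"

text \<open>With \<open>m = length ws\<close>, the bound on \<open>j + k\<close> gives
  \<open>tau ws k <= tau ws (m + 1 - j) = ws ! (j - 1)\<close>, so the block lies inside
  \<open>R_{1j}\<close> and all nested indices are in range.\<close>

lemma tau_block_eq:
  assumes s: "sorted_wrt (\<ge>) ws" and j: "1 \<le> j" and k: "1 \<le> k" "j + k \<le> length ws + 1"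
    and i: "1 \<le> i" "i \<le> length ws"
    and I: "length (idx_seq Is (length ws)) = ws ! 0" "set (idx_seq Is (length ws)) \<subseteq> {0..<r}"
  shows "tau_block ws r Is R j i k =
    mat (tau ws i - tau ws (i - 1)) (tau ws k - tau ws (k - 1))
      (\<lambda>(x, y). R $$ (idx_seq Is (length ws) ! (tau ws (i - 1) + x),
                      off ws (j - 1) + (tau ws (k - 1) + y)))"
proof -
  let ?I = "idx_seq Is (length ws)"
  have jm: "j - 1 < length ws" using j k by simp
  have "sum_list (take j ws) = off ws (j - 1) + ws ! (j - 1)"
    using jm j take_Suc_conv_app_nth[of "j - 1" ws] by (simp add: off_def)
  then have F: "first_block ws r R j = mat r (ws ! (j - 1)) (\<lambda>(c, b). R $$ (c, off ws (j - 1) + b))"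
    by (auto simp: first_block_def sub_mat_def off_def)
  have "tau ws i \<le> tau ws (length ws)" using tau_mono[OF s] i by simp
  moreover have "tau ws (length ws) = ws ! 0" using i by (auto simp: tau_def)
  ultimately have ti: "tau ws i \<le> ws ! 0" by simp
  have "tau ws k \<le> tau ws (length ws - (j - 1))" using tau_mono[OF s] k j by simp
  moreover have "tau ws (length ws - (j - 1)) = ws ! (j - 1)" using jm by (simp add: tau_def)
  ultimately have tk: "tau ws k \<le> ws ! (j - 1)" by simp
  have "?I ! c < r" if "c < ws ! 0" for c
    using I that by (metis atLeastLessThan_iff nth_mem subsetD)
  then show ?thesis
    unfolding tau_block_def F using ti tk I(1)
    by (intro eq_matI) (auto simp: sub_mat_def)
qed

text \<open>With \<open>m = length ws\<close>, position \<open>(c, b)\<close> lies in the cell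
  \<open>i = m + 1 - height ws c\<close>, \<open>k = m + 1 - height ws b\<close>. In block column
  \<open>j + 1\<close> the bounds \<open>i - j <= k\<close> and \<open>k <= m - j\<close> then read
  \<open>height ws b <= height ws c + j\<close> and \<open>j < height ws b\<close>.\<close>

lemma reduced_form_iff:
  assumes s: "sorted_wrt (\<ge>) ws" and "ws \<noteq> []"
    and I: "length (idx_seq Is (length ws)) = ws ! 0" "set (idx_seq Is (length ws)) \<subseteq> {0..<rs ! 0}"
  shows "reduced_form l ws rs Is R \<longleftrightarrow>
    R \<in> P_mats (weyr_mat l ws) rs \<and> reduced_entries ws (idx_seq Is (length ws)) R"
proof -
  let ?I = "idx_seq Is (length ws)" and ?m = "length ws"
  let ?B = "tau_block ws (rs ! 0) Is R"
  let ?d = "\<lambda>i. tau ws i - tau ws (i - 1)"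
  note B = tau_block_eq[OF s _ _ _ _ _ I]
  have top: "c < ws ! 0 \<longleftrightarrow> 0 < height ws c" for c
    using less_height_iff[OF s, of 0 c] \<open>ws \<noteq> []\<close> by simp
  define Z where "Z \<longleftrightarrow> (\<forall>i \<in> {1..?m}. ?B 1 i i = 1\<^sub>m (?d i)) \<and>
     (\<forall>i \<in> {1..?m}. \<forall>k \<in> {i<..?m}. ?B 1 i k = 0\<^sub>m (?d i) (?d k)) \<and>
     (\<forall>j \<in> {2..?m}. \<forall>i \<in> {1..?m}. \<forall>k \<in> {max (i + 1 - j) 1..?m + 1 - j}.
        ?B j i k = 0\<^sub>m (?d i) (?d k))"
  have "Z \<longleftrightarrow> reduced_entries ws ?I R"
  proof
    assume Z: Z
    show "reduced_entries ws ?I R"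
      unfolding reduced_entries_def
    proof (intro allI impI)
      fix c b j assume c: "c < ws ! 0" and j: "j < height ws b" and h: "height ws b \<le> height ws c + j"
      define i where "i = ?m + 1 - height ws c"
      define k where "k = ?m + 1 - height ws b"
      have i: "1 \<le> i" "i \<le> ?m" "height ws c = ?m + 1 - i"
        using c top[of c] height_le_length[of ws c] by (auto simp: i_def)
      have k: "1 \<le> k" "k \<le> ?m" "height ws b = ?m + 1 - k"
        using j height_le_length[of ws b] by (auto simp: k_def)
      have ci: "tau ws (i - 1) \<le> c" "c < tau ws i" and bk: "tau ws (k - 1) \<le> b" "b < tau ws k"
        using tau_interval_iff_height[OF s i(1,2)] i(3) tau_interval_iff_height[OF s k(1,2)] k(3)
        by blast+
      have entry: "?B (Suc j) i k $$ (c - tau ws (i - 1), b - tau ws (k - 1)) =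
          R $$ (?I ! c, off ws j + b)"
        using B[of "Suc j" k i] i k j ci bk by simp
      show "R $$ (?I ! c, off ws j + b) = (if j = 0 \<and> c = b then 1 else 0)"
      proof (cases "j = 0")
        case True
        then have "i \<le> k" using h i k by linarith
        then consider "i = k" | "i < k" by linarith
        then show ?thesis
        proof cases
          case 1
          then have "?B (Suc j) i k = 1\<^sub>m (?d i)" using Z i True unfolding Z_def by simp
          then show ?thesis unfolding entry[symmetric] using 1 ci bk True by auto
        next
          case 2
          then have "?B (Suc j) i k = 0\<^sub>m (?d i) (?d k)" using Z i k True unfolding Z_def by simp
          moreover have "c \<noteq> b" using 2 i k by auto
          ultimately show ?thesis unfolding entry[symmetric] using ci bk by auto
        qed
      next
        case False
        then have "Suc j \<in> {2..?m}" "i \<in> {1..?m}" "k \<in> {max (i + 1 - Suc j) 1..?m + 1 - Suc j}"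
          using i k j h by auto
        then have "?B (Suc j) i k = 0\<^sub>m (?d i) (?d k)" using Z unfolding Z_def by blast
        then show ?thesis unfolding entry[symmetric] using ci bk False by auto
      qed
    qed
  next
    assume E: "reduced_entries ws ?I R"
    \<comment> \<open>One formula covers all three families of blocks; \<open>i + 1 <= j + k\<close>
      expresses the lower bound on \<open>k\<close> without truncated subtraction.\<close>
    have R: "?B j i k = mat (?d i) (?d k)
        (\<lambda>(x, y). if j = 1 \<and> tau ws (i - 1) + x = tau ws (k - 1) + y then 1 else 0)"
      if "1 \<le> j" "1 \<le> i" "i \<le> ?m" "1 \<le> k" "j + k \<le> ?m + 1" "i + 1 \<le> j + k" for j i k
    proof -
      have "R $$ (?I ! (tau ws (i - 1) + x), off ws (j - 1) + (tau ws (k - 1) + y)) =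
          (if j = 1 \<and> tau ws (i - 1) + x = tau ws (k - 1) + y then 1 else 0)"
        if x: "x < ?d i" and y: "y < ?d k" for x y
      proof -
        have hx: "height ws (tau ws (i - 1) + x) = ?m + 1 - i"
          using tau_interval_iff_height[OF s, of i "tau ws (i - 1) + x"] x \<open>1 \<le> i\<close> \<open>i \<le> ?m\<close> by auto
        have "k \<le> ?m" using \<open>1 \<le> j\<close> \<open>j + k \<le> ?m + 1\<close> by simp
        then have hy: "height ws (tau ws (k - 1) + y) = ?m + 1 - k"
          using tau_interval_iff_height[OF s, of k "tau ws (k - 1) + y"] y \<open>1 \<le> k\<close> by auto
        have "tau ws (i - 1) + x < ws ! 0" using hx top \<open>i \<le> ?m\<close> by simp
        moreover have "j - 1 < height ws (tau ws (k - 1) + y)"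
          unfolding hy using \<open>1 \<le> j\<close> \<open>1 \<le> k\<close> \<open>j + k \<le> ?m + 1\<close> by linarith
        moreover have "height ws (tau ws (k - 1) + y) \<le> height ws (tau ws (i - 1) + x) + (j - 1)"
          unfolding hx hy using \<open>1 \<le> j\<close> \<open>i \<le> ?m\<close> \<open>i + 1 \<le> j + k\<close> by linarith
        moreover have "j - 1 = 0 \<longleftrightarrow> j = 1" using \<open>1 \<le> j\<close> by auto
        ultimately show ?thesis using E unfolding reduced_entries_def by metis
      qed
      then show ?thesis
        using that by (subst B) (auto intro!: cong_mat)
    qed
    have "?B 1 i i = 1\<^sub>m (?d i)" if "i \<in> {1..?m}" for i
      using that by (subst R) auto
    moreover have "?B 1 i k = 0\<^sub>m (?d i) (?d k)" if i: "i \<in> {1..?m}" and k: "k \<in> {i<..?m}" for i k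
    proof -
      have "tau ws i \<le> tau ws (k - 1)" using tau_mono[OF s, of i "k - 1"] k by auto
      then have "\<not> tau ws (i - 1) + x = tau ws (k - 1) + y" if "x < ?d i" for x y
        using that by linarith
      then show ?thesis using i k by (subst R) (auto intro!: eq_matI)
    qed
    moreover have "?B j i k = 0\<^sub>m (?d i) (?d k)"
      if "j \<in> {2..?m}" "i \<in> {1..?m}" "k \<in> {max (i + 1 - j) 1..?m + 1 - j}" for j i k
      using that by (subst R) auto
    ultimately show Z unfolding Z_def by blast
  qed
  then show ?thesis unfolding reduced_form_def Let_def Z_def by blast
qed

section \<open>Admissible index sequences\<close>

lemma admissible_prefix:
  assumes adm: "admissible ws r P Is" and "j \<le> k" "k \<le> length ws"
  shows "\<exists>K. idx_seq Is k = idx_seq Is j @ K"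
  using assms(2,3)
proof (induction k)
  case (Suc k)
  show ?case
  proof (cases "j = Suc k")
    case False
    then obtain K where "idx_seq Is k = idx_seq Is j @ K" using Suc by auto
    moreover have "Suc k \<in> {1..length ws}" using Suc.prems by simp
    then have "\<exists>J \<in> Q_seqs (tau ws (Suc k) - tau ws (Suc k - 1)) r.
        idx_seq Is (Suc k) = idx_seq Is (Suc k - 1) @ J"
      using adm unfolding admissible_def by blast
    ultimately show ?thesis by auto
  qed simp
qed simp

text \<open>For \<open>t = length ws - k\<close> the first \<open>ws ! k = tau ws t\<close> entries
  of \<open>I_m\<close> form its initial segment \<open>I_t\<close>, so \<open>M\<close> is
  \<open>P(I_t, 1:tau_t)\<close>.\<close>

lemma admissible_invertible:
  assumes adm: "admissible ws r P Is" and k: "k < length ws"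
    and P: "P \<in> carrier_mat n (sum_list ws)"
  defines "M \<equiv> mat (ws ! k) (ws ! k) (\<lambda>(c, a). P $$ (idx_seq Is (length ws) ! c, a))"
  shows "invertible_mat M"
proof -
  let ?t = "length ws - k"
  have t: "?t \<in> {1..length ws}" and tau: "tau ws ?t = ws ! k" using k by (auto simp: tau_def)
  then have len: "length (idx_seq Is ?t) = ws ! k"
    and inv: "invertible_mat (sub_mat P (idx_seq Is ?t) [0..<ws ! k])"
    using adm unfolding admissible_def by metis+
  obtain K where K: "idx_seq Is (length ws) = idx_seq Is ?t @ K"
    using admissible_prefix[OF adm, of ?t "length ws"] by auto
  have "sub_mat P (idx_seq Is ?t) [0..<ws ! k] = M"
    unfolding M_def sub_mat_def by (rule eq_matI) (auto simp: len K nth_append)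
  then show ?thesis using inv by simp
qed

section \<open>Existence and uniqueness of the normalizing matrix\<close>

lemma nth_le_nth_0:
  assumes "sorted_wrt (\<ge>) ws" and "i < length ws"
  shows "ws ! i \<le> (ws ! 0 :: nat)"
  using assms by (cases i) (auto simp: sorted_wrt_iff_nth_less)

lemma height_pred_less: "j < height ws b \<Longrightarrow> height ws b - 1 - j < length ws"
  using height_le_length[of ws b] by simp

text \<open>This makes the systems square: for fixed \<open>j\<close> and \<open>b\<close>, the rows
  \<open>c\<close> prescribed by \<open>reduced_entries\<close> and the \<open>a\<close> where
  \<open>F a j b\<close> may be nonzero form the same initial segment.\<close>

lemma less_nth_height_iff:
  assumes "sorted_wrt (\<ge>) ws" and "j < height ws b"
  shows "c < ws ! (height ws b - 1 - j) \<longleftrightarrow> height ws b \<le> height ws c + j"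
  using less_height_iff[OF assms(1), of "height ws b - 1 - j" c] height_pred_less[OF assms(2)] assms(2)
  by auto

lemma admissible_last:
  assumes "admissible ws r P Is" and "ws \<noteq> []"
  shows "length (idx_seq Is (length ws)) = ws ! 0" "set (idx_seq Is (length ws)) \<subseteq> {0..<r}"
proof -
  have "length ws \<in> {1..length ws}" "tau ws (length ws) = ws ! 0"
    using assms(2) by (auto simp: tau_def Suc_le_eq)
  then show "length (idx_seq Is (length ws)) = ws ! 0" "set (idx_seq Is (length ws)) \<subseteq> {0..<r}"
    using assms(1) unfolding admissible_def by metis+
qed

lemma admissible_last_less:
  assumes "admissible ws r P Is" and "ws \<noteq> []" and "c < ws ! 0"
  shows "idx_seq Is (length ws) ! c < r"
proof -
  have "idx_seq Is (length ws) ! c \<in> set (idx_seq Is (length ws))"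
    using admissible_last(1)[OF assms(1,2)] assms(3) by simp
  then show ?thesis using admissible_last(2)[OF assms(1,2)] by auto
qed

lemma weyr_normalizer_exists:
  assumes s: "sorted_wrt (\<ge>) ws" and ne: "ws \<noteq> []" and adm: "admissible ws r P Is"
    and P: "P \<in> carrier_mat n (sum_list ws)" and "r \<le> n"
  shows "\<exists>X \<in> centralizer (weyr_mat l ws). reduced_entries ws (idx_seq Is (length ws)) (P * X)"
proof -
  let ?I = "idx_seq Is (length ws)" and ?s = "sum_list ws"
  let ?N = "\<lambda>b j. ws ! (height ws b - 1 - j)"
  let ?A = "\<lambda>c i a. P $$ (?I ! c, off ws i + a)"
  note N = height_pred_less nth_le_nth_0[OF s height_pred_less]
  note less_N = less_nth_height_iff[OF s]
  let ?sol = "\<lambda>b f. \<forall>j<height ws b. (\<forall>a\<ge>?N b j. f j a = 0) \<and>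
      (\<forall>c<?N b j. (\<Sum>i\<le>j. \<Sum>a<ws ! i. ?A c i a * f (j - i) a) = (if j = 0 \<and> c = b then 1 else 0))"
  have "\<exists>f. ?sol b f" for b
  \<comment> \<open>As \<open>off ws 0 = 0\<close>, the leading coefficients come from the first
    columns of \<open>P\<close>; cut to size \<open>?N b j\<close> they form one of the matrices
    that admissibility makes invertible.\<close>
  proof (rule block_recursion_solvable)
    fix j and y :: "nat \<Rightarrow> real" assume j: "j < height ws b"
    show "\<exists>x. \<forall>c<?N b j. (\<Sum>a<?N b j. ?A c 0 a * x a) = y c"
      using invertible_mat_solve[OF mat_carrier admissible_invertible[OF adm N(1)[OF j] P], of y]
      by simp
  qed (rule N)
  then have "\<exists>f. \<forall>b. ?sol b (f b)"
    by (intro choice allI)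
  then obtain f where sols: "?sol b (f b)" for b
    by (elim exE) (rule that, erule spec)
  then have f: "\<And>b j a. j < height ws b \<Longrightarrow> a \<ge> ?N b j \<Longrightarrow> f b j a = 0"
    and sol: "\<And>b j c. j < height ws b \<Longrightarrow> c < ?N b j \<Longrightarrow>
      (\<Sum>i\<le>j. \<Sum>a<ws ! i. ?A c i a * f b (j - i) a) = (if j = 0 \<and> c = b then 1 else 0)"
    using sols by simp_all
  define F where "F a j b = f b j a" for a j b
  \<comment> \<open>\<open>loc\<close> decodes a position into its pair, which is unique by
    \<open>off_add_inj\<close>.\<close>
  define loc where "loc p = (SOME (i, a). i < height ws a \<and> p = off ws i + a)" for p
  have loc: "loc (off ws i + a) = (i, a)" if "i < height ws a" for i a
    unfolding loc_def
  proof (rule some_equality)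
    fix q assume "case q of (i', a') \<Rightarrow> i' < height ws a' \<and> off ws i + a = off ws i' + a'"
    then have q: "fst q < height ws (snd q)" "off ws i + a = off ws (fst q) + snd q"
      by (simp_all add: case_prod_beta)
    show "q = (i, a)"
      using off_add_inj[OF less_heightD[OF s that] less_heightD[OF s q(1)] q(2)]
      by (simp add: prod_eq_iff)
  qed (use that in simp)
  define X where "X = mat ?s ?s (\<lambda>(p, q). case (loc p, loc q) of ((i, a), (j, b)) \<Rightarrow>
    if i \<le> j then F a (j - i) b else 0)"
  have T: "weyr_toeplitz ws F X"
    unfolding weyr_toeplitz_def
  proof (intro conjI allI impI)
    fix i a j b assume "i < height ws a" "j < height ws b"
    then show "X $$ (off ws i + a, off ws j + b) = (if i \<le> j then F a (j - i) b else 0)"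
      using off_add_less less_heightD[OF s] by (simp add: X_def loc)
  next
    fix a j b assume "0 < height ws a" "height ws a + j < height ws b"
    then show "F a j b = 0" using f[of j b a] less_N[of j b a] by (auto simp: F_def)
  qed (simp add: X_def)
  have "?I ! c < n" if "c < ws ! 0" for c
    using admissible_last_less[OF adm ne that] \<open>r \<le> n\<close> by simp
  then have red: "reduced_entries ws ?I (P * X)"
    unfolding reduced_entries_def
    using mult_weyr_toeplitz_index[OF s T P] sol less_N by (simp add: F_def)
  have "invertible_mat X"
  \<comment> \<open>For \<open>c <= b\<close> the heights satisfy
    \<open>height ws b <= height ws c\<close>, so the equations at \<open>j = 0\<close> prescribe
    these entries: \<open>P(I_m, 1:w_1)\<close> times the first diagonal block of \<open>X\<close>
    is lower unitriangular.\<close>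
  proof (rule weyr_toeplitz_invertible[OF s T])
    fix c b assume cb: "c \<le> b" "b < ws ! 0"
    then have "0 < height ws b" using less_height_iff[OF s] ne by simp
    moreover have "c < ?N b 0" using less_N[of 0 b c] height_antimono[OF s cb(1)] calculation by simp
    ultimately show "(\<Sum>a<ws ! 0. ?A c 0 a * F a 0 b) = (if c = b then 1 else 0)"
      using sol[of 0 b c] by (simp add: F_def)
  qed
  moreover have "X \<in> carrier_mat ?s ?s" by (simp add: X_def)
  ultimately have "X \<in> centralizer (weyr_mat l ws)"
    using weyr_toeplitz_imp_commutes[OF s T] carrier_matD[OF weyr_mat_carrier[of l ws]]
    by (simp add: centralizer_def)
  with red show ?thesis by blast
qed

text \<open>The first block rows of \<open>X\<close> and \<open>Y\<close> satisfy the same recursion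
  with injective leading systems, and a matrix in the centralizer is determined by its first block
  row.\<close>

lemma weyr_normalizer_unique:
  assumes s: "sorted_wrt (\<ge>) ws" and ne: "ws \<noteq> []" and adm: "admissible ws r P Is"
    and P: "P \<in> carrier_mat n (sum_list ws)" and "r \<le> n"
    and X: "X \<in> centralizer (weyr_mat l ws)" "reduced_entries ws (idx_seq Is (length ws)) (P * X)"
    and Y: "Y \<in> centralizer (weyr_mat l ws)" "reduced_entries ws (idx_seq Is (length ws)) (P * Y)"
  shows "X = Y"
proof -
  let ?I = "idx_seq Is (length ws)" and ?s = "sum_list ws"
  let ?N = "\<lambda>b j. ws ! (height ws b - 1 - j)"
  let ?A = "\<lambda>c i a. P $$ (?I ! c, off ws i + a)"
  note N = height_pred_less nth_le_nth_0[OF s height_pred_less]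
  note less_N = less_nth_height_iff[OF s]
  have carrier: "Z \<in> carrier_mat ?s ?s"
    and toeplitz: "weyr_toeplitz ws (\<lambda>a j b. Z $$ (a, off ws j + b)) Z"
    if "Z \<in> centralizer (weyr_mat l ws)" for Z
  proof -
    show Z: "Z \<in> carrier_mat ?s ?s"
      using that carrier_matD[OF weyr_mat_carrier[of l ws]] by (simp add: centralizer_def)
    show "weyr_toeplitz ws (\<lambda>a j b. Z $$ (a, off ws j + b)) Z"
      using commutes_imp_weyr_toeplitz[OF s Z, of l] that by (simp add: centralizer_def)
  qed
  have top: "0 < height ws a" if "a < ws ! 0" for a
    using that less_height_iff[OF s] ne by simp
  have vanish: "Z $$ (a, off ws j + b) = 0"
    if "Z \<in> centralizer (weyr_mat l ws)" "j < height ws b" "?N b j \<le> a" "a < ws ! 0" for Z a j b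
  proof -
    have "height ws a + j < height ws b"
      using less_N[OF that(2), of a] that(3) by simp
    then show ?thesis using toeplitz[OF that(1)] top[OF that(4)] unfolding weyr_toeplitz_def by blast
  qed
  have product: "(\<Sum>i\<le>j. \<Sum>a<ws ! i. ?A c i a * Z $$ (a, off ws (j - i) + b)) =
      (if j = 0 \<and> c = b then 1 else 0)"
    if Z: "Z \<in> centralizer (weyr_mat l ws)" "reduced_entries ws ?I (P * Z)"
      and j: "j < height ws b" and c: "c < ?N b j" for Z j b c
  proof -
    have c0: "c < ws ! 0" using c N(2)[OF j] by simp
    have "?I ! c < n" using admissible_last_less[OF adm ne c0] \<open>r \<le> n\<close> by simp
    then show ?thesis
      using mult_weyr_toeplitz_index[OF s toeplitz[OF Z(1)] P _ j, of "?I ! c"] Z(2) c0 j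
        less_N[OF j, of c] c
      unfolding reduced_entries_def by simp
  qed
  have first: "X $$ (a, off ws j + b) = Y $$ (a, off ws j + b)"
    if "j < height ws b" "a < ws ! 0" for a j b
  proof (rule block_recursion_unique[where n = "height ws b" and N = "?N b" and w = "(!) ws" and A = ?A
        and f = "\<lambda>j a. X $$ (a, off ws j + b)" and g = "\<lambda>j a. Y $$ (a, off ws j + b)"])
    fix j and x :: "nat \<Rightarrow> real" and a
    assume j: "j < height ws b" and a: "a < ?N b j"
      and "\<And>c. c < ?N b j \<Longrightarrow> (\<Sum>a<?N b j. ?A c 0 a * x a) = 0"
    then show "x a = 0"
      using invertible_mat_kernel[OF mat_carrier admissible_invertible[OF adm N(1)[OF j] P], of x a]
      by simp
  next
    fix i assume "i < height ws b"
    then show "ws ! i \<le> ws ! 0" using nth_le_nth_0[OF s] less_heightD[OF s] by blast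
  qed (use that N vanish X(1) Y(1) product[OF X] product[OF Y] in auto)
  show ?thesis
  proof (rule eq_matI)
    fix p q assume "p < dim_row Y" "q < dim_col Y"
    then have pq: "p < ?s" "q < ?s" using carrier[OF Y(1)] by auto
    obtain i a where i: "i < length ws" "a < ws ! i" "p = off ws i + a" using off_cases[OF pq(1)] .
    obtain j b where j: "j < length ws" "b < ws ! j" "q = off ws j + b" using off_cases[OF pq(2)] .
    have ia: "i < height ws a" and jb: "j < height ws b" using i j less_height_iff[OF s] by auto
    \<comment> \<open>The Toeplitz shape reduces block \<open>(i, j)\<close> to block
      \<open>(0, j - i)\<close>, where \<open>first\<close> applies.\<close>
    have "a < ws ! 0" using i nth_le_nth_0[OF s i(1)] by simp
    then show "X $$ (p, q) = Y $$ (p, q)"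
      using toeplitz[OF X(1)] toeplitz[OF Y(1)] ia jb first[of "j - i" b a] i(3) j(3)
      unfolding weyr_toeplitz_def by auto
  qed (use carrier[OF X(1)] carrier[OF Y(1)] in auto)
qed

theorem theorem5p8:
  fixes ws rs :: "nat list" and l :: real and P :: "real mat" and Is :: "nat list list"
  assumes "ws \<noteq> []" and "sorted_wrt (\<ge>) ws" and "\<forall>w \<in> set ws. w \<ge> 1"
    and "rs \<noteq> []" and "sorted_wrt (\<ge>) rs" and "\<forall>q \<in> set rs. q > 0"
    and "P_mats (weyr_mat l ws) rs \<noteq> {}"
    and "P \<in> P_mats (weyr_mat l ws) rs"
    and "admissible ws (rs ! 0) P Is"
  shows "\<exists>!R. reduced_form l ws rs Is R \<and> C_equiv (weyr_mat l ws) P R"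
proof -
  note ne = assms(1) and s = assms(2) and P = assms(8) and adm = assms(9)
  note iff = reduced_form_iff[OF s ne admissible_last[OF adm ne]]
  have Pc: "P \<in> carrier_mat (sum_list rs) (sum_list ws)"
    using P_mats_carrier[OF P] carrier_matD[OF weyr_mat_carrier[of l ws]] by simp
  have r: "rs ! 0 \<le> sum_list rs" using assms(4) by (cases rs) auto
  obtain X where X: "X \<in> centralizer (weyr_mat l ws)"
    "reduced_entries ws (idx_seq Is (length ws)) (P * X)"
    using weyr_normalizer_exists[OF s ne adm Pc r] by blast
  show ?thesis
  \<comment> \<open>Any other candidate is \<open>P * Y\<close> with \<open>Y\<close> in the
    centralizer, so uniqueness of the form follows from \<open>Y = X\<close>.\<close>
  proof (rule ex1I[of _ "P * X"])
    show "reduced_form l ws rs Is (P * X) \<and> C_equiv (weyr_mat l ws) P (P * X)"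
      using iff X P_mats_mult_centralizer[OF weyr_mat_carrier assms(5) P X(1)]
      by (auto simp: C_equiv_def)
  next
    fix R assume R: "reduced_form l ws rs Is R \<and> C_equiv (weyr_mat l ws) P R"
    then obtain Y where Y: "Y \<in> centralizer (weyr_mat l ws)" "R = P * Y"
      unfolding C_equiv_def by blast
    then show "R = P * X"
      using weyr_normalizer_unique[OF s ne adm Pc r Y(1) _ X] R iff by blast
  qed
qed

end
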